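(* Let $p$ be a prime and $s_1,s_2$ nonnegative integers. Let $f,g\in\mathbb{Z}[x]$ be monic with resultant $r$, such that $v_p(f(n))\ge s_1$ and $v_p(g(n))\ge s_2$ for every integer $n$. Then $$v_p(r)\ \ge\ p\sum_{i=0}^{\infty}p^i\,\widehat\gamma_i(s_1)\,\widehat\gamma_i(s_2)$$ (with $v_p(0)=\infty$).
   Context: For a nonnegative integer $\omega$, an integral resolution of $\omega$ is a sequence $(\gamma_i)_{i\ge0}$ of nonnegative integers with $\gamma_i\ge p\gamma_{i+1}$ for all $i$ and $\sum_{i\ge0}\gamma_i=\omega$. The minimal integral resolution $(\widehat\gamma_i(\omega))_{i\ge0}$ is the lexicographically smallest integral resolution of $\omega$. The resultant of monic $f=\prod_i(x-\alpha_i)$, $g=\prod_j(x-\beta_j)$ is $r=\prod_{i,j}(\alpha_i-\beta_j)$. *)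

theory Defs
  imports "Subresultants.Resultant_Prelim" "HOL-Computational_Algebra.Primes"
begin

text \<open>Integral resolution of \<omega> (w.r.t. the prime p): a sequence of nonnegative
integers with gamma i \<ge> p * gamma (i+1) for all i and total sum \<omega>.  Since the
entries are nonnegative integers with finite total sum, the sequence has finite
support, and the sum is the sum over its support.\<close>
definition int_resolution :: "nat \<Rightarrow> nat \<Rightarrow> (nat \<Rightarrow> nat) \<Rightarrow> bool" where
  "int_resolution p \<omega> \<gamma> \<longleftrightarrow>
     (\<forall>i. \<gamma> i \<ge> p * \<gamma> (Suc i)) \<and>
     finite {i. \<gamma> i \<noteq> 0} \<and>
     (\<Sum>i\<in>{i. \<gamma> i \<noteq> 0}. \<gamma> i) = \<omega>"

definition lex_less :: "(nat \<Rightarrow> nat) \<Rightarrow> (nat \<Rightarrow> nat) \<Rightarrow> bool" where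
  "lex_less \<gamma> \<delta> \<longleftrightarrow> (\<exists>k. (\<forall>i<k. \<gamma> i = \<delta> i) \<and> \<gamma> k < \<delta> k)"

definition min_resolution :: "nat \<Rightarrow> nat \<Rightarrow> (nat \<Rightarrow> nat)" where
  "min_resolution p \<omega> = (THE \<gamma>. int_resolution p \<omega> \<gamma> \<and>
      (\<forall>\<delta>. int_resolution p \<omega> \<delta> \<longrightarrow> \<delta> \<noteq> \<gamma> \<longrightarrow> lex_less \<gamma> \<delta>))"

end

theory Submission
  imports Defs
begin

text \<open>Write \<open>(x)\<^sub>m\<close> for the falling factorials and, for a resolution \<open>\<gamma>\<close>, put
  \<open>c\<^sub>\<gamma>(m) = (\<Sum>i. max 0 (\<gamma>\<^sub>i - \<lfloor>m / p\<^bsup>i+1\<^esup>\<rfloor>))\<close>.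
  If \<open>p\<^sup>s\<close> divides all values of \<open>f\<close>, then \<open>f\<close> lies in the lattice \<open>L(\<gamma>)\<close> spanned by the
  \<open>p\<^bsup>c\<^sub>\<gamma>(m)\<^esup> (x)\<^sub>m\<close>, where \<open>\<gamma>\<close> is the minimal resolution of \<open>s\<close>, and
  \<open>L(\<gamma>) L(\<delta>) \<subseteq> L(\<gamma> + \<delta>)\<close>. Hence \<open>(u, v) \<mapsto> u f + v g\<close> maps the elements of
  \<open>L(\<delta>) \<times> L(\<gamma>)\<close> of degree less than \<open>deg g\<close> and \<open>deg f\<close> into those of \<open>L(\<gamma> + \<delta>)\<close> of degree less
  than \<open>deg f + deg g\<close>. As the determinant of this map is the resultant up to sign,
  comparing the indices of these lattices gives
  \<open>v\<^sub>p(r) \<ge> \<Sum> c\<^bsub>\<gamma>+\<delta>\<^esub>(m) - \<Sum> c\<^sub>\<gamma>(m) - \<Sum> c\<^sub>\<delta>(m)\<close>. The sum of \<open>c\<^sub>\<gamma>\<close> is the quadratic form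
  \<open>\<Sum>i. p\<^bsup>i+1\<^esup> \<gamma>\<^sub>i (\<gamma>\<^sub>i + 1) / 2\<close>, whose polarization is the claimed bound.\<close>

section \<open>Valuations of factorials\<close>

lemma multiplicity_eq_sum_dvd:
  fixes p n K :: nat
  assumes p: "prime p" and n: "0 < n" "n \<le> K"
  shows "multiplicity p n = (\<Sum>i<K. if p ^ Suc i dvd n then 1 else 0)"
proof -
  have nu: "\<not> is_unit p" using p by (simp add: prime_nat_iff)
  have iff: "p ^ Suc i dvd n \<longleftrightarrow> i < multiplicity p n" for i
    using power_dvd_iff_le_multiplicity[of n p "Suc i"] nu n by auto
  have "p ^ multiplicity p n \<le> n" using multiplicity_dvd n(1) by (intro dvd_imp_le)
  moreover have "multiplicity p n < p ^ multiplicity p n"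
    using prime_gt_1_nat[OF p] by (intro power_gt_expt) simp
  ultimately have "multiplicity p n \<le> K" using n by linarith
  then have "{i \<in> {..<K}. i < multiplicity p n} = {..<multiplicity p n}" by auto
  then have "(\<Sum>i<K. if i < multiplicity p n then 1 else 0) = multiplicity p n"
    by (subst sum.inter_filter[symmetric]) simp_all
  then show ?thesis unfolding iff by simp
qed

text \<open>Legendre's formula. Any \<open>K\<close> \<ge> \<open>n\<close> may cut off the sum, so
  factorials of different arguments can share one range.\<close>

lemma multiplicity_fact:
  fixes p n K :: nat
  assumes p: "prime p" and "n \<le> K"
  shows "multiplicity p (fact n :: nat) = (\<Sum>i<K. n div p ^ Suc i)"
  using assms(2)
proof (induction n)
  case 0
  then show ?case by simp
next
  case (Suc n)
  have "Suc n div d = n div d + (if d dvd Suc n then 1 else 0)" for d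
    by (auto simp: div_Suc dvd_eq_mod_eq_0)
  moreover have "multiplicity p (fact (Suc n) :: nat) = multiplicity p (Suc n) + multiplicity p (fact n :: nat)"
    using prime_elem_multiplicity_mult_distrib[of p "Suc n" "fact n :: nat"] p by (simp add: prime_elem_nat_iff)
  moreover have "multiplicity p (Suc n) = (\<Sum>i<K. if p ^ Suc i dvd Suc n then 1 else 0)"
    using Suc.prems by (intro multiplicity_eq_sum_dvd p) auto
  ultimately show ?case using Suc by (simp add: sum.distrib)
qed

text \<open>Legendre's formula with its first term split off. The greedy resolution is analysed by
  the same recursion from \<open>n\<close> to \<open>n div p\<close>.\<close>

lemma multiplicity_fact_div:
  fixes p n :: nat
  assumes p: "prime p"
  shows "multiplicity p (fact n :: nat) = n div p + multiplicity p (fact (n div p) :: nat)"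
proof -
  have "multiplicity p (fact n :: nat) = (\<Sum>i<Suc n. n div p ^ Suc i)"
    by (rule multiplicity_fact[OF p]) simp
  also have "\<dots> = n div p + (\<Sum>i<n. (n div p) div p ^ Suc i)"
    by (simp add: sum.lessThan_Suc_shift div_mult2_eq del: sum.lessThan_Suc)
  also have "(\<Sum>i<n. (n div p) div p ^ Suc i) = multiplicity p (fact (n div p) :: nat)"
    by (rule multiplicity_fact[OF p, symmetric]) simp
  finally show ?thesis .
qed

lemma multiplicity_fact_mono:
  fixes p m n :: nat
  assumes p: "prime p" and "m \<le> n"
  shows "multiplicity p (fact m :: nat) \<le> multiplicity p (fact n :: nat)"
  by (intro dvd_imp_multiplicity_le fact_dvd assms) auto

section \<open>The exponents of the lattice attached to a resolution\<close>

text \<open>The exponent c of the overview, cut off after \<open>K\<close> levels; subtraction of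
  naturals supplies the maximum with 0.\<close>

definition defect :: "nat \<Rightarrow> nat \<Rightarrow> (nat \<Rightarrow> nat) \<Rightarrow> nat \<Rightarrow> nat" where
  "defect p K \<gamma> m = (\<Sum>i<K. \<gamma> i - m div p ^ Suc i)"

text \<open>Once \<gamma> i \<le> floor(l / p^(i+1)), dividing by p gives the same at i + 1. So
  truncation at 0 affects only a tail, and the defect is an untruncated, hence additive, sum over an
  initial segment.\<close>

lemma defect_cutoff:
  assumes res: "\<And>i. p * \<gamma> (Suc i) \<le> \<gamma> i" and p: "0 < p"
  obtains k where "k \<le> K" "int (defect p K \<gamma> l) = (\<Sum>i<k. int (\<gamma> i) - int (l div p ^ Suc i))"
proof -
  define P where "P i \<longleftrightarrow> \<gamma> i \<le> l div p ^ Suc i" for i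
  define k where "k = (LEAST i. P i \<or> K \<le> i)"
  have "P k \<or> K \<le> k" unfolding k_def by (rule LeastI[of _ K]) simp
  have kK: "k \<le> K" unfolding k_def by (rule Least_le) simp
  have less: "\<not> P i" if "i < k" for i using not_less_Least that unfolding k_def by blast
  have step: "P (Suc i)" if "P i" for i
  proof -
    have "\<gamma> (Suc i) \<le> \<gamma> i div p" using res[of i] p by (simp add: less_eq_div_iff_mult_less_eq mult.commute)
    also have "\<dots> \<le> (l div p ^ Suc i) div p" using that unfolding P_def by (rule div_le_mono)
    also have "\<dots> = l div p ^ Suc (Suc i)" by (simp add: div_mult2_eq[symmetric] mult.commute)
    finally show ?thesis unfolding P_def .
  qed
  have ge: "P i" if "k \<le> i" "i < K" for i
    using that by (induction i rule: dec_induct) (use \<open>P k \<or> K \<le> k\<close> step in auto)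
  have "defect p K \<gamma> l = (\<Sum>i<k. \<gamma> i - l div p ^ Suc i)"
    unfolding defect_def using kK ge by (intro sum.mono_neutral_right) (auto simp: P_def)
  also have "int \<dots> = (\<Sum>i<k. int (\<gamma> i) - int (l div p ^ Suc i))"
    unfolding of_nat_sum 
    using less[unfolded P_def not_le, THEN less_imp_le] by (intro sum.cong refl of_nat_diff) simp
  finally show ?thesis using that kK by blast
qed

lemma div_add_ge: "(a :: nat) div d + b div d \<le> (a + b) div d"
  by (subst div_add1_eq) simp

text \<open>The binomial expression is the coefficient of \<open>(x)\<^bsub>m+n-j\<^esub>\<close> in \<open>(x)\<^sub>m (x)\<^sub>n\<close>.\<close>
lemma defect_ff_mult:
  fixes p m n j :: nat
  assumes p: "prime p" and jm: "j \<le> m" and jn: "j \<le> n"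
    and res: "\<And>i. p * (\<gamma> (Suc i) + \<delta> (Suc i)) \<le> \<gamma> i + \<delta> i"
  shows "defect p K (\<lambda>i. \<gamma> i + \<delta> i) (m + n - j)
           \<le> defect p K \<gamma> m + defect p K \<delta> n + multiplicity p ((m choose j) * (n choose j) * fact j)"
proof -
  let ?C = "(m choose j) * (n choose j) * fact j"
  let ?l = "m + n - j"
  obtain k where k: "k \<le> K"
    and def: "int (defect p K (\<lambda>i. \<gamma> i + \<delta> i) ?l) = (\<Sum>i<k. int (\<gamma> i + \<delta> i) - int (?l div p ^ Suc i))"
    using defect_cutoff[of p "\<lambda>i. \<gamma> i + \<delta> i" K ?l] res prime_gt_0_nat[OF p] by blast
  \<comment> \<open>\<open>k\<close> belongs to the sum sequence at \<open>?l\<close>. For \<gamma>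
    and \<delta> alone, the untruncated sum over the same segment is still a lower bound, which is
    all that is needed.\<close>
  have lower: "(\<Sum>i<k. int (\<eta> i) - int (x div p ^ Suc i)) \<le> int (defect p K \<eta> x)" for \<eta> x
  proof -
    have "(\<Sum>i<k. int (\<eta> i) - int (x div p ^ Suc i)) \<le> (\<Sum>i<k. int (\<eta> i - x div p ^ Suc i))"
      by (intro sum_mono) auto
    also have "\<dots> \<le> (\<Sum>i<K. int (\<eta> i - x div p ^ Suc i))"
      using k by (intro sum_mono2) auto
    finally show ?thesis unfolding defect_def by simp
  qed
  \<comment> \<open>\<open>t i\<close> is the i-th Legendre term of m! n! / (j! (m-j)! (n-j)!),
    which equals \<open>?C\<close>.\<close>
  define t where "t i = int (m div p ^ Suc i) + int (n div p ^ Suc i) - int (j div p ^ Suc i)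
      - int ((m - j) div p ^ Suc i) - int ((n - j) div p ^ Suc i)" for i
  \<comment> \<open>Both bounds rest on superadditivity of the floor, the second through
    \<open>?l\<close> = j + (m-j) + (n-j). The first allows the sum to be extended from
    \<open>k\<close> to \<open>M\<close>.\<close>
  have t: "0 \<le> t i" "int (m div p ^ Suc i) + int (n div p ^ Suc i) - int (?l div p ^ Suc i) \<le> t i" for i
    using div_add_ge[of j "p ^ Suc i" "m - j"] div_add_ge[of 0 "p ^ Suc i" "n - j"]
      div_add_ge[of j "p ^ Suc i" "(m - j) + (n - j)"] div_add_ge[of "m - j" "p ^ Suc i" "n - j"]
      div_le_mono[of "n - j" n "p ^ Suc i"] jm jn
    unfolding t_def by (auto simp: algebra_simps)
  define M where "M = m + n + k"
  have "?C * (fact j * fact (m - j) * fact (n - j)) = (fact m * fact n :: nat)"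
    using binomial_fact_lemma[OF jm] binomial_fact_lemma[OF jn] by (metis (no_types, lifting) mult.assoc mult.commute mult.left_commute)
  then have "multiplicity p (?C * (fact j * fact (m - j) * fact (n - j))) = multiplicity p (fact m * fact n :: nat)"
    by (rule arg_cong)
  then have vC: "multiplicity p ?C + (multiplicity p (fact j :: nat) + multiplicity p (fact (m - j) :: nat) + multiplicity p (fact (n - j) :: nat))
      = multiplicity p (fact m :: nat) + multiplicity p (fact n :: nat)"
    using jm jn p by (simp add: prime_elem_multiplicity_mult_distrib prime_imp_prime_elem)
  have vx: "multiplicity p (fact x :: nat) = (\<Sum>i<M. x div p ^ Suc i)" if "x \<le> m + n" for x
    using that by (intro multiplicity_fact[OF p]) (simp add: M_def)
  from vC vx[of m] vx[of n] vx[of j] vx[of "m - j"] vx[of "n - j"]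
  have tC: "(\<Sum>i<M. t i) = int (multiplicity p ?C)"
    using jm jn unfolding t_def sum_subtractf sum.distrib of_nat_sum[symmetric] by linarith
  have "(\<Sum>i<k. t i) \<le> (\<Sum>i<M. t i)" using t by (intro sum_mono2) (auto simp: M_def)
  moreover have "(\<Sum>i<k. int (m div p ^ Suc i) + int (n div p ^ Suc i) - int (?l div p ^ Suc i)) \<le> (\<Sum>i<k. t i)"
    by (intro sum_mono t)
  ultimately show ?thesis using lower[of \<gamma> m] lower[of \<delta> n] def tC
    by (simp add: sum_subtractf sum.distrib)
qed

text \<open>Raising \<open>g\<close> by one adds 1 exactly at the m < \<open>q * Suc g\<close>, all
  of which lie below \<open>N\<close>. The sum is thus q (1 + ... + g), doubled to avoid a
  division.\<close>

lemma sum_monus_div: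
  fixes q g N :: nat
  assumes "0 < q" "q * g \<le> N"
  shows "2 * (\<Sum>m<N. g - m div q) = q * (g * Suc g)"
  using assms(2)
proof (induction g)
  case 0
  then show ?case by simp
next
  case (Suc g)
  have "(\<Sum>m<N. Suc g - m div q) = (\<Sum>m<N. (g - m div q) + (if m < q * Suc g then 1 else 0))"
  proof (intro sum.cong refl)
    fix m
    have "m < q * Suc g \<longleftrightarrow> m div q < Suc g"
      using div_less_iff_less_mult[OF assms(1)] by (simp add: mult.commute)
    then show "Suc g - m div q = (g - m div q) + (if m < q * Suc g then 1 else 0)" by auto
  qed
  also have "\<dots> = (\<Sum>m<N. g - m div q) + q * Suc g"
  proof -
    have "{m \<in> {..<N}. m < q * Suc g} = {..<q * Suc g}" using Suc.prems by auto
    then have "(\<Sum>m<N. if m < q * Suc g then 1 else 0) = q * Suc g"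
      by (subst sum.inter_filter[symmetric]) simp_all
    then show ?thesis by (simp only: sum.distrib)
  qed
  finally show ?case using Suc by (simp add: algebra_simps)
qed

text \<open>Summed level by level: p^(i+1) \<gamma> i is nonincreasing in i, so
  \<open>p * \<gamma> 0 \<le> N\<close> places the nonzero terms of every level below
  \<open>N\<close>.\<close>

lemma sum_defect:
  assumes p: "0 < p" and res: "\<And>i. p * \<gamma> (Suc i) \<le> \<gamma> i" and N: "p * \<gamma> 0 \<le> N"
  shows "2 * (\<Sum>m<N. defect p K \<gamma> m) = (\<Sum>i<K. p ^ Suc i * (\<gamma> i * Suc (\<gamma> i)))"
proof -
  have le: "p ^ Suc i * \<gamma> i \<le> N" for i
  proof (induction i)
    case (Suc i)
    have "p ^ Suc (Suc i) * \<gamma> (Suc i) = p ^ Suc i * (p * \<gamma> (Suc i))" by simp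
    also have "\<dots> \<le> p ^ Suc i * \<gamma> i" by (intro mult_left_mono res) simp
    finally show ?case using Suc by linarith
  qed (use N in simp)
  have "(\<Sum>m<N. defect p K \<gamma> m) = (\<Sum>i<K. \<Sum>m<N. \<gamma> i - m div p ^ Suc i)"
    unfolding defect_def by (rule sum.swap)
  then show ?thesis using sum_monus_div[OF _ le] p by (simp add: sum_distrib_left)
qed

text \<open>Polarization: (x+y)(x+y+1) = x(x+1) + y(y+1) + 2xy at each level.\<close>

lemma sum_defect_add:
  assumes p: "0 < p"
    and res: "\<And>i. p * \<gamma> (Suc i) \<le> \<gamma> i" "\<And>i. p * \<delta> (Suc i) \<le> \<delta> i"
    and N: "p * \<gamma> 0 \<le> d" "p * \<delta> 0 \<le> e"
  shows "(\<Sum>m<d + e. defect p K (\<lambda>i. \<gamma> i + \<delta> i) m)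
    = (\<Sum>m<d. defect p K \<gamma> m) + (\<Sum>m<e. defect p K \<delta> m) + (\<Sum>i<K. p ^ Suc i * \<gamma> i * \<delta> i)"
proof -
  have "2 * (\<Sum>m<d + e. defect p K (\<lambda>i. \<gamma> i + \<delta> i) m)
      = (\<Sum>i<K. p ^ Suc i * ((\<gamma> i + \<delta> i) * Suc (\<gamma> i + \<delta> i)))"
    using res N by (intro sum_defect[OF p]) (auto simp: algebra_simps intro: add_mono)
  also have "\<dots> = (\<Sum>i<K. p ^ Suc i * (\<gamma> i * Suc (\<gamma> i))) + (\<Sum>i<K. p ^ Suc i * (\<delta> i * Suc (\<delta> i)))
      + 2 * (\<Sum>i<K. p ^ Suc i * \<gamma> i * \<delta> i)"
    unfolding sum_distrib_left sum.distrib[symmetric] by (intro sum.cong) (auto simp: algebra_simps)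
  finally show ?thesis using sum_defect[OF p res(1) N(1), of K] sum_defect[OF p res(2) N(2), of K] by simp
qed

section \<open>The minimal resolution\<close>

text \<open>A resolution starting with \<open>q\<close> has sum at most \<open>(\<Sum>i. \<lfloor>q / p\<^sup>i\<rfloor>) = q + v\<^sub>p(q!)\<close>, so the minimal one
  can be built greedily from its first entry.\<close>
definition lead :: "nat \<Rightarrow> nat \<Rightarrow> nat" where
  "lead p s = (LEAST q. s \<le> q + multiplicity p (fact q :: nat))"

text \<open>The amount still to be distributed after i greedy choices. Recursing on the amount makes
  the tail of a greedy resolution definitionally a greedy resolution again.\<close>

primrec remainder :: "nat \<Rightarrow> nat \<Rightarrow> nat \<Rightarrow> nat" where
  "remainder p s 0 = s"
| "remainder p s (Suc i) = remainder p (s - lead p s) i"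

definition greedy :: "nat \<Rightarrow> nat \<Rightarrow> nat \<Rightarrow> nat" where
  "greedy p s i = lead p (remainder p s i)"

lemma lead_ge: "s \<le> lead p s + multiplicity p (fact (lead p s) :: nat)"
  unfolding lead_def by (rule LeastI[of _ s]) simp

lemma lead_le: "s \<le> q + multiplicity p (fact q :: nat) \<Longrightarrow> lead p s \<le> q"
  unfolding lead_def by (rule Least_le)

lemma lead_le_self: "lead p s \<le> s"
  by (rule lead_le) simp

lemma lead_pos: "0 < s \<Longrightarrow> 0 < lead p s"
  using lead_ge[of s p] by (cases "lead p s") auto

lemma lead_0 [simp]: "lead p 0 = 0"
  using lead_le_self[of p 0] by simp

lemma greedy_0: "greedy p s 0 = lead p s"
  and greedy_Suc: "greedy p s (Suc i) = greedy p (s - lead p s) i"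
  by (simp_all add: greedy_def)

lemma remainder_Suc: "remainder p s (Suc i) = remainder p s i - greedy p s i"
proof (induction i arbitrary: s)
  case (Suc i)
  then show ?case by (simp only: remainder.simps(2) greedy_Suc)
qed (simp add: greedy_def)

lemma remainder_le: "remainder p s i \<le> s - i"
proof (induction i arbitrary: s)
  case (Suc i)
  have "s - lead p s \<le> s - 1" using lead_pos[of s p] by (cases "s = 0") auto
  then show ?case using Suc[of "s - lead p s"] by simp
qed simp

lemma greedy_eq_0: "s \<le> i \<Longrightarrow> greedy p s i = 0"
  using remainder_le[of p s i] by (simp add: greedy_def)

text \<open>After the choice of q at most v_p(q!) = floor(q/p) + v_p(floor(q/p)!) is left, so
  floor(q/p) is a candidate for the next entry, which is the least candidate.\<close>

lemma greedy_resolution: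
  assumes p: "prime p"
  shows "p * greedy p s (Suc i) \<le> greedy p s i"
proof -
  let ?t = "remainder p s i"
  have "?t - lead p ?t \<le> multiplicity p (fact (lead p ?t) :: nat)" using lead_ge[of ?t p] by simp
  then have "lead p (?t - lead p ?t) \<le> lead p ?t div p"
    by (intro lead_le) (simp flip: multiplicity_fact_div[OF p])
  then show ?thesis
    using prime_gt_0_nat[OF p]
    by (simp add: greedy_def remainder_Suc less_eq_div_iff_mult_less_eq mult.commute del: remainder.simps)
qed

lemma sum_greedy: "(\<Sum>i<k. greedy p s i) + remainder p s k = s"
proof (induction k)
  case (Suc k)
  have "greedy p s k \<le> remainder p s k" unfolding greedy_def by (rule lead_le_self)
  then show ?case using Suc by (simp add: remainder_Suc del: remainder.simps(2))
qed simp

text \<open>This bound ties the greedy resolution to divisibility: p^s | a m! forces p^(s - v_p(m!))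
  | a. Peeling off the first level replaces \<open>s\<close> by \<open>s - lead p s\<close> and
  \<open>m\<close> by \<open>m div p\<close>.\<close>

lemma defect_greedy_le:
  assumes p: "prime p"
  shows "defect p K (greedy p s) m \<le> s - multiplicity p (fact m :: nat)"
proof (induction K arbitrary: s m)
  case 0
  then show ?case by (simp add: defect_def)
next
  case (Suc K)
  let ?v = "\<lambda>n. multiplicity p (fact n :: nat)"
  let ?q = "m div p"
  have split: "defect p (Suc K) (greedy p s) m = (lead p s - ?q) + defect p K (greedy p (s - lead p s)) ?q"
    unfolding defect_def sum.lessThan_Suc_shift by (simp add: greedy_0 greedy_Suc div_mult2_eq)
  have IH: "defect p K (greedy p (s - lead p s)) ?q \<le> (s - lead p s) - ?v ?q" by (rule Suc)
  have v: "?v m = ?q + ?v ?q" by (rule multiplicity_fact_div[OF p])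
  show ?case
  proof (cases "lead p s \<le> ?q")
    case True
    \<comment> \<open>Here the first level contributes 0, and s - lead \<le> v_p(lead!) \<le>
      v_p(\<open>?q\<close>!) makes the tail vanish too.\<close>
    then have "?v (lead p s) \<le> ?v ?q" by (rule multiplicity_fact_mono[OF p])
    then show ?thesis using lead_ge[of s p] IH split True by linarith
  next
    case False
    have "\<not> s \<le> ?q + ?v ?q" using lead_le[of s ?q p] False by linarith
    \<comment> \<open>Minimality of \<open>lead\<close> just below itself gives s - lead \<ge>
      v_p(\<open>?q\<close>!), so no subtraction truncates and the two levels add up
      exactly.\<close>
    have "\<not> s \<le> (lead p s - 1) + ?v (lead p s - 1)" using lead_le[of s "lead p s - 1" p] False by linarith
    moreover have "?v ?q \<le> ?v (lead p s - 1)" using False by (intro multiplicity_fact_mono[OF p]) simp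
    ultimately show ?thesis using IH split v False lead_le_self[of p s] by linarith
  qed
qed

lemma greedy_nz_imp_less: "greedy p s i \<noteq> 0 \<Longrightarrow> i < s"
  by (rule ccontr) (simp add: greedy_eq_0)

lemma int_resolution_greedy:
  assumes p: "prime p"
  shows "int_resolution p s (greedy p s)"
proof -
  have sub: "{i. greedy p s i \<noteq> 0} \<subseteq> {..<s}"
    using greedy_nz_imp_less by blast
  then have "(\<Sum>i\<in>{i. greedy p s i \<noteq> 0}. greedy p s i) = (\<Sum>i<s. greedy p s i)"
    by (intro sum.mono_neutral_left) auto
  also have "\<dots> = s" using sum_greedy[of p s s] remainder_le[of p s s] by simp
  finally show ?thesis
    using sub greedy_resolution[OF p] finite_subset[OF sub] by (auto simp: int_resolution_def)
qed

text \<open>Iterating the condition gives \<gamma> i \<le> floor(\<gamma> 0 / p^i), and these bounds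
  sum to Legendre's formula for \<gamma> 0.\<close>

lemma sum_resolution_le:
  assumes p: "prime p" and res: "\<And>i. p * \<gamma> (Suc i) \<le> \<gamma> i"
  shows "(\<Sum>i<n. \<gamma> i) \<le> \<gamma> 0 + multiplicity p (fact (\<gamma> 0) :: nat)"
proof -
  have le: "\<gamma> i \<le> \<gamma> 0 div p ^ i" for i
  proof (induction i)
    case (Suc i)
    have "\<gamma> (Suc i) \<le> \<gamma> i div p"
      using res[of i] prime_gt_0_nat[OF p] by (simp add: less_eq_div_iff_mult_less_eq mult.commute)
    also have "\<dots> \<le> (\<gamma> 0 div p ^ i) div p" using Suc by (rule div_le_mono)
    also have "\<dots> = \<gamma> 0 div p ^ Suc i" by (simp add: div_mult2_eq[symmetric] mult.commute)
    finally show ?case .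
  qed simp
  have "(\<Sum>i<n. \<gamma> i) \<le> (\<Sum>i<Suc (n + \<gamma> 0). \<gamma> i)" by (intro sum_mono2) auto
  also have "\<dots> = \<gamma> 0 + (\<Sum>i<n + \<gamma> 0. \<gamma> (Suc i))" by (rule sum.lessThan_Suc_shift)
  also have "\<dots> \<le> \<gamma> 0 + (\<Sum>i<n + \<gamma> 0. \<gamma> 0 div p ^ Suc i)" by (intro add_left_mono sum_mono le)
  also have "\<dots> = \<gamma> 0 + multiplicity p (fact (\<gamma> 0) :: nat)"
    by (subst multiplicity_fact[OF p, of _ "n + \<gamma> 0"]) simp_all
  finally show ?thesis .
qed

text \<open>At the first difference k both sequences have \<open>remainder p s k\<close> left. The
  tail of \<delta> sums to it, so \<delta> k is a candidate in the minimum that defines the greedy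
  entry.\<close>

lemma greedy_lex_less:
  assumes p: "prime p" and res: "int_resolution p s \<delta>" and ne: "\<delta> \<noteq> greedy p s"
  shows "lex_less (greedy p s) \<delta>"
proof -
  define k where "k = (LEAST i. \<delta> i \<noteq> greedy p s i)"
  have "\<exists>i. \<delta> i \<noteq> greedy p s i" using ne by auto
  then have k: "\<delta> k \<noteq> greedy p s k" unfolding k_def by (rule LeastI_ex)
  have eq: "\<delta> i = greedy p s i" if "i < k" for i using not_less_Least that unfolding k_def by blast
  have fin: "finite {i. \<delta> i \<noteq> 0}" and sum: "(\<Sum>i\<in>{i. \<delta> i \<noteq> 0}. \<delta> i) = s"
    and step: "\<And>i. p * \<delta> (Suc i) \<le> \<delta> i" using res by (auto simp: int_resolution_def)
  obtain n where n: "{i. \<delta> i \<noteq> 0} \<subseteq> {..<n}" using finite_nat_iff_bounded[THEN iffD1, OF fin] by blast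
  have "s = (\<Sum>i<k + n. \<delta> i)"
    unfolding sum[symmetric] using n by (intro sum.mono_neutral_left) auto
  also have "\<dots> = (\<Sum>i<k. \<delta> i) + (\<Sum>i<n. \<delta> (k + i))" by (induction n) (simp_all add: add.assoc)
  also have "(\<Sum>i<k. \<delta> i) = (\<Sum>i<k. greedy p s i)" using eq by (intro sum.cong) auto
  finally have "remainder p s k = (\<Sum>i<n. \<delta> (k + i))" using sum_greedy[of p s k] by linarith
  also have "\<dots> \<le> \<delta> k + multiplicity p (fact (\<delta> k) :: nat)"
    using sum_resolution_le[OF p, of "\<lambda>i. \<delta> (k + i)" n] step by simp
  finally have "greedy p s k \<le> \<delta> k" unfolding greedy_def by (rule lead_le)
  then show ?thesis using k eq by (auto simp: lex_less_def intro!: exI[of _ k])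
qed

lemma lex_less_asym: "lex_less \<gamma> \<delta> \<Longrightarrow> \<not> lex_less \<delta> \<gamma>"
proof
  assume "lex_less \<gamma> \<delta>" "lex_less \<delta> \<gamma>"
  then obtain k l where "\<forall>i<k. \<gamma> i = \<delta> i" "\<gamma> k < \<delta> k" "\<forall>i<l. \<delta> i = \<gamma> i" "\<delta> l < \<gamma> l"
    unfolding lex_less_def by blast
  then show False by (cases k l rule: linorder_cases) auto
qed

lemma min_resolution_eq_greedy:
  assumes p: "prime p"
  shows "min_resolution p s = greedy p s"
  unfolding min_resolution_def
proof (rule the_equality)
  show "int_resolution p s (greedy p s)
      \<and> (\<forall>\<delta>. int_resolution p s \<delta> \<longrightarrow> \<delta> \<noteq> greedy p s \<longrightarrow> lex_less (greedy p s) \<delta>)"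
    by (intro conjI allI impI int_resolution_greedy[OF p] greedy_lex_less[OF p])
next
  fix \<gamma>
  assume *: "int_resolution p s \<gamma> \<and> (\<forall>\<delta>. int_resolution p s \<delta> \<longrightarrow> \<delta> \<noteq> \<gamma> \<longrightarrow> lex_less \<gamma> \<delta>)"
  then show "\<gamma> = greedy p s"
    using greedy_lex_less[OF p] int_resolution_greedy[OF p] lex_less_asym by metis
qed

section \<open>Divisibility of the resultant\<close>

lemma det_upper_triangular_prod:
  assumes "A \<in> carrier_mat n n" "upper_triangular A"
  shows "det A = (\<Prod>i<n. A $$ (i, i))"
  using assms by (simp add: det_upper_triangular diag_mat_def lessThan_atLeast0
    flip: prod.distinct_set_conv_list)

lemma prod_lessThan_add: "(\<Prod>i<(m::nat) + n. h i) = (\<Prod>i<m. h i) * (\<Prod>i<n. h (m + i) :: 'a :: comm_monoid_mult)"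
  by (induction n) (simp_all add: mult.assoc)

text \<open>Expands a product along the shifts x^l h, whose coefficients form the rows of a
  Sylvester matrix.\<close>

lemma coeff_mult_shift:
  fixes q h :: "'a :: comm_semiring_1 poly"
  assumes "\<And>l. n \<le> l \<Longrightarrow> coeff q l = 0"
  shows "coeff (q * h) t = (\<Sum>l<n. coeff q l * coeff (monom 1 l * h) t)"
proof -
  have "q = (\<Sum>l<n. smult (coeff q l) (monom 1 l))"
  proof (rule poly_eqI)
    fix i
    have "coeff (\<Sum>l<n. smult (coeff q l) (monom 1 l)) i = (\<Sum>l<n. if l = i then coeff q l else 0)"
      unfolding coeff_sum by (intro sum.cong) (auto simp: coeff_monom)
    then show "coeff q i = coeff (\<Sum>l<n. smult (coeff q l) (monom 1 l)) i"
      using assms[of i] by (auto simp: not_less)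
  qed
  then have "q * h = (\<Sum>l<n. smult (coeff q l) (monom 1 l)) * h" by (rule arg_cong)
  then show ?thesis by (simp add: sum_distrib_right coeff_sum)
qed

text \<open>\<open>B\<close> and \<open>V\<close> hold the coefficients of the \<open>u\<^sub>j, v\<^sub>j\<close> and of the \<open>w\<^sub>m\<close>, both in descending
  order as in the Sylvester matrix \<open>S\<close>, so that they are upper triangular and \<open>B S = W V\<close>.\<close>
lemma prod_coeff_dvd_resultant:
  fixes f g :: "'a :: comm_ring_1 poly"
  defines "d \<equiv> degree f" and "e \<equiv> degree g"
  assumes u: "\<And>j. j < e \<Longrightarrow> degree (u j) \<le> j"
    and v: "\<And>j. j < d \<Longrightarrow> degree (v j) \<le> j"
    and w: "\<And>j. j < d + e \<Longrightarrow> degree (w j) \<le> j"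
    and uf: "\<And>j. j < e \<Longrightarrow> \<exists>b. u j * f = (\<Sum>m<d + e. smult (b m) (w m))"
    and vg: "\<And>j. j < d \<Longrightarrow> \<exists>b. v j * g = (\<Sum>m<d + e. smult (b m) (w m))"
  shows "(\<Prod>m<d + e. coeff (w m) m)
    dvd (\<Prod>j<e. coeff (u j) j) * (\<Prod>j<d. coeff (v j) j) * resultant f g"
proof -
  define N where "N = e + d"
  \<comment> \<open>Row i of both matrix products will hold the coefficients of \<open>R i\<close>:
    first the multiples of \<open>f\<close>, then those of \<open>g\<close>, each with falling
    index.\<close>
  define R where "R i = (if i < e then u (e - Suc i) * f else v (N - Suc i) * g)" for i
  have "\<forall>i. \<exists>b. i < N \<longrightarrow> R i = (\<Sum>m<N. smult (b m) (w m))"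
    using uf vg unfolding R_def N_def by (auto simp: add.commute)
  then obtain b where b: "\<And>i. i < N \<Longrightarrow> R i = (\<Sum>m<N. smult (b i m) (w m))" by metis
  define W where "W = mat N N (\<lambda>(i, k). b i (N - Suc k))"
  define V where "V = mat N N (\<lambda>(k, j). coeff (w (N - Suc k)) (N - Suc j))"
  \<comment> \<open>Block diagonal, as the \<open>u\<close> multiply only shifts of \<open>f\<close>
    and the \<open>v\<close> only shifts of \<open>g\<close>.\<close>
  define B where "B = mat N N (\<lambda>(i, k). if i < e then if k < e then coeff (u (e - Suc i)) (e - Suc k) else 0
      else if k < e then 0 else coeff (v (N - Suc i)) (N - Suc k))"
  define S where "S = mat N N (\<lambda>(k, j). coeff (if k < e then monom 1 (e - Suc k) * f else monom 1 (N - Suc k) * g) (N - Suc j))"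
  have carrier: "W \<in> carrier_mat N N" "V \<in> carrier_mat N N" "B \<in> carrier_mat N N" "S \<in> carrier_mat N N"
    unfolding W_def V_def B_def S_def by auto
  have res: "resultant f g = det S"
  proof -
    have "sylvester_mat f g = S"
    proof (rule eq_matI)
      fix i j assume "i < dim_row S" "j < dim_col S"
      then have ij: "i < N" "j < N" using carrier by auto
      then have *: "i < degree f + degree g" "j < degree f + degree g" by (auto simp: N_def d_def e_def)
      show "sylvester_mat f g $$ (i, j) = S $$ (i, j)"
        using ij unfolding sylvester_index_mat[OF *] S_def
        by (auto simp: coeff_monom_mult N_def d_def e_def coeff_eq_0 not_le add.commute
          intro: arg_cong[where f = "coeff f"] arg_cong[where f = "coeff g"])
    qed (use carrier in \<open>auto simp: N_def d_def e_def\<close>)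
    then show ?thesis unfolding resultant_def by simp
  qed
  have "B * S = W * V"
  proof (rule eq_matI)
    fix i j assume "i < dim_row (W * V)" "j < dim_col (W * V)"
    then have ij: "i < N" "j < N" using carrier by auto
    have "(W * V) $$ (i, j) = (\<Sum>k<N. b i (N - Suc k) * coeff (w (N - Suc k)) (N - Suc j))"
      using ij carrier by (simp add: scalar_prod_def W_def V_def lessThan_atLeast0)
    also have "\<dots> = (\<Sum>m<N. b i m * coeff (w m) (N - Suc j))"
      by (rule sum.nat_diff_reindex)
    also have "\<dots> = coeff (R i) (N - Suc j)"
      unfolding b[OF ij(1)] by (simp add: coeff_sum)
    finally have WV: "(W * V) $$ (i, j) = coeff (R i) (N - Suc j)" .
    have BS: "(B * S) $$ (i, j) = (\<Sum>k<e. B $$ (i, k) * S $$ (k, j)) + (\<Sum>k<d. B $$ (i, e + k) * S $$ (e + k, j))"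
    proof -
      have "(B * S) $$ (i, j) = (\<Sum>k<N. B $$ (i, k) * S $$ (k, j))"
        using ij carrier by (simp add: scalar_prod_def lessThan_atLeast0)
      also have "\<dots> = (\<Sum>k<e. B $$ (i, k) * S $$ (k, j)) + (\<Sum>k<d. B $$ (i, e + k) * S $$ (e + k, j))"
        unfolding N_def by (induction d) (simp_all add: add.assoc)
      finally show ?thesis .
    qed
    show "(B * S) $$ (i, j) = (W * V) $$ (i, j)"
    proof (cases "i < e")
      case True
      let ?q = "u (e - Suc i)"
      have q: "coeff ?q l = 0" if "e \<le> l" for l
        using u[of "e - Suc i"] True that by (intro coeff_eq_0) auto
      have "(B * S) $$ (i, j) = (\<Sum>k<e. coeff ?q (e - Suc k) * coeff (monom 1 (e - Suc k) * f) (N - Suc j))"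
        unfolding BS using ij True by (simp add: B_def S_def N_def)
      also have "\<dots> = (\<Sum>l<e. coeff ?q l * coeff (monom 1 l * f) (N - Suc j))"
        by (rule sum.nat_diff_reindex)
      also have "\<dots> = coeff (R i) (N - Suc j)"
        using coeff_mult_shift[of e ?q f "N - Suc j", OF q] True by (simp add: R_def)
      finally show ?thesis using WV by simp
    next
      case False
      let ?q = "v (N - Suc i)"
      have q: "coeff ?q l = 0" if "d \<le> l" for l
        
      proof (rule coeff_eq_0)
        have "N - Suc i < d" using False ij by (simp add: N_def)
        then show "degree ?q < l" using v[of "N - Suc i"] that by linarith
      qed
      have "(B * S) $$ (i, j) = (\<Sum>k<d. coeff ?q (d - Suc k) * coeff (monom 1 (d - Suc k) * g) (N - Suc j))"
        unfolding BS using ij False by (simp add: B_def S_def N_def)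
      also have "\<dots> = (\<Sum>l<d. coeff ?q l * coeff (monom 1 l * g) (N - Suc j))"
        by (rule sum.nat_diff_reindex)
      also have "\<dots> = coeff (R i) (N - Suc j)"
        using coeff_mult_shift[of d ?q g "N - Suc j", OF q] False by (simp add: R_def)
      finally show ?thesis using WV by simp
    qed
  qed (use carrier in auto)
  then have "det B * det S = det W * det V"
    using carrier by (metis det_mult)
  moreover have "det V = (\<Prod>m<N. coeff (w m) m)"
  proof -
    have "upper_triangular V"
      using carrier w by (intro upper_triangularI) (auto simp: V_def N_def intro!: coeff_eq_0 le_less_trans[OF w])
    then have "det V = (\<Prod>i<N. V $$ (i, i))" by (rule det_upper_triangular_prod[OF carrier(2)])
    also have "\<dots> = (\<Prod>i<N. coeff (w (N - Suc i)) (N - Suc i))" by (simp add: V_def)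
    also have "\<dots> = (\<Prod>m<N. coeff (w m) m)" by (rule prod.nat_diff_reindex)
    finally show ?thesis .
  qed
  moreover have "det B = (\<Prod>j<e. coeff (u j) j) * (\<Prod>j<d. coeff (v j) j)"
  proof -
    have "upper_triangular B"
      using carrier
      by (intro upper_triangularI)
        (auto simp: B_def N_def intro!: coeff_eq_0 le_less_trans[OF u] le_less_trans[OF v])
    then have "det B = (\<Prod>i<e + d. B $$ (i, i))"
      using det_upper_triangular_prod[OF carrier(3)] by (simp add: N_def)
    also have "\<dots> = (\<Prod>i<e. coeff (u (e - Suc i)) (e - Suc i)) * (\<Prod>i<d. coeff (v (d - Suc i)) (d - Suc i))"
      unfolding prod_lessThan_add by (simp add: B_def N_def)
    also have "\<dots> = (\<Prod>j<e. coeff (u j) j) * (\<Prod>j<d. coeff (v j) j)"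
      unfolding prod.nat_diff_reindex[of "\<lambda>j. coeff (u j) j"] prod.nat_diff_reindex[of "\<lambda>j. coeff (v j) j"] ..
    finally show ?thesis .
  qed
  \<comment> \<open>\<open>det W\<close> is the cofactor that witnesses the divisibility.\<close>
  ultimately have "(\<Prod>j<e. coeff (u j) j) * (\<Prod>j<d. coeff (v j) j) * resultant f g = det W * (\<Prod>m<N. coeff (w m) m)"
    unfolding res by simp
  then show ?thesis unfolding N_def by (metis add.commute dvd_triv_right)
qed

section \<open>Falling factorials\<close>

definition ff :: "nat \<Rightarrow> int poly" where
  "ff m = (\<Prod>i<m. [:- int i, 1:])"

lemma ff_0 [simp]: "ff 0 = 1" and ff_Suc: "ff (Suc m) = ff m * [:- int m, 1:]"
  by (simp_all add: ff_def)

lemma monic_ff: "monic (ff m)"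
  by (simp add: ff_def monic_prod)

lemma degree_ff: "degree (ff m) = m"
proof (induction m)
  case (Suc m)
  have "ff m \<noteq> 0" using monic_ff[of m] by auto
  then show ?case unfolding ff_Suc using Suc by (subst degree_mult_eq) auto
qed simp

lemma coeff_ff: "coeff (ff m) m = 1"
  using monic_ff[of m] by (simp add: degree_ff)

lemma poly_ff: "poly (ff m) (int n) = int (fact m * (n choose m))"
proof (induction m)
  case (Suc m)
  have "(n choose Suc m) * Suc m = (n choose m) * (n - m)"
    using binomial_absorb_comp[of n m] binomial_absorption[of m n]
    by (cases "m \<le> n") (simp_all add: mult.commute binomial_eq_0)
  then have "fact m * ((n choose Suc m) * Suc m) = fact m * ((n choose m) * (n - m))"
    by (rule arg_cong)
  then have "fact (Suc m) * (n choose Suc m) = fact m * (n choose m) * (n - m)"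
    by (simp add: algebra_simps)
  moreover have "int (n choose m) * (int n - int m) = int ((n choose m) * (n - m))"
    by (cases "m \<le> n") (auto simp: binomial_eq_0 of_nat_diff)
  ultimately show ?case using Suc by (simp add: ff_Suc algebra_simps)
qed simp

lemma ff_basis:
  assumes "\<And>l. n \<le> l \<Longrightarrow> coeff h l = 0"
  shows "\<exists>a. h = (\<Sum>m<n. smult (a m) (ff m))"
  using assms
proof (induction n arbitrary: h)
  case 0
  then show ?case by (simp add: poly_eqI)
next
  case (Suc n)
  define h' where "h' = h - smult (coeff h n) (ff n)"
  have "coeff h' l = 0" if "n \<le> l" for l
  proof (cases "l = n")
    case True
    then show ?thesis by (simp add: h'_def coeff_ff)
  next
    case False
    then show ?thesis using that Suc.prems[of l] by (simp add: h'_def coeff_eq_0 degree_ff)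
  qed
  from Suc.IH[OF this] obtain a where a: "h' = (\<Sum>m<n. smult (a m) (ff m))" by blast
  have "h = (\<Sum>m<Suc n. smult ((a(n := coeff h n)) m) (ff m))"
    using a by (simp add: h'_def algebra_simps)
  then show ?case by blast
qed

text \<open>Induction on \<open>n\<close>, multiplying each term by x - n = (x - (m+n-j)) + (m - j):
  the first part raises the falling factorial, the second feeds the coefficient at j + 1.\<close>

lemma ff_mult:
  "ff m * ff n = (\<Sum>j\<le>n. smult (int ((m choose j) * (n choose j) * fact j)) (ff (m + n - j)))"
proof (induction n)
  case 0
  then show ?case by simp
next
  case (Suc n)
  define K where "K n j = int ((m choose j) * (n choose j) * fact j)" for n j
  have K0: "K n (Suc n) = 0" by (simp add: K_def)
  have rec: "K (Suc n) (Suc j) = K n (Suc j) + K n j * (int m - int j)" for j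
  proof -
    have "(m choose Suc j) * Suc j = (m choose j) * (m - j)"
      using binomial_absorb_comp[of m j] binomial_absorption[of j m]
      by (cases "j \<le> m") (simp_all add: mult.commute binomial_eq_0)
    then have "int (m choose Suc j) * int (Suc j) = int ((m choose j) * (m - j))"
      by (metis of_nat_mult)
    also have "\<dots> = int (m choose j) * (int m - int j)"
      by (cases "j \<le> m") (auto simp: binomial_eq_0 of_nat_diff)
    finally have *: "int (m choose Suc j) * int (Suc j) = int (m choose j) * (int m - int j)" .
    have "K (Suc n) (Suc j) = K n (Suc j) + int (n choose j) * int (fact j) * (int (m choose Suc j) * int (Suc j))"
      by (simp add: K_def algebra_simps)
    then show ?thesis unfolding * by (simp add: K_def algebra_simps)
  qed
  have step: "smult (K n j) (ff (m + n - j) * [:- int n, 1:])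
      = smult (K n j) (ff (m + Suc n - j)) + smult (K n j * (int m - int j)) (ff (m + n - j))" if "j \<le> n" for j
  proof -
    have "[:- int n, 1:] = [:- int (m + n - j), 1:] + [:int m - int j:]" using that by simp
    moreover have "m + Suc n - j = Suc (m + n - j)" using that by simp
    ultimately show ?thesis by (simp only: ff_Suc distrib_left smult_add_right) (simp add: mult.commute)
  qed
  have "ff m * ff (Suc n) = (\<Sum>j\<le>n. smult (K n j) (ff (m + n - j) * [:- int n, 1:]))"
    using Suc by (simp add: ff_Suc mult.assoc[symmetric] sum_distrib_right K_def del: mult_pCons_right)
  also have "\<dots> = (\<Sum>j\<le>n. smult (K n j) (ff (m + Suc n - j)))
      + (\<Sum>j\<le>n. smult (K n j * (int m - int j)) (ff (m + n - j)))"
    unfolding sum.distrib[symmetric] by (intro sum.cong refl step) simp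
  \<comment> \<open>The added term is zero; with it the index can be shifted so that both sums run
    over the same falling factorials.\<close>
  also have "(\<Sum>j\<le>n. smult (K n j) (ff (m + Suc n - j))) = (\<Sum>j\<le>Suc n. smult (K n j) (ff (m + Suc n - j)))"
    by (simp add: K0)
  also have "\<dots> = smult (K n 0) (ff (m + Suc n)) + (\<Sum>j\<le>n. smult (K n (Suc j)) (ff (m + n - j)))"
    by (simp add: sum.atMost_Suc_shift del: sum.atMost_Suc)
  also have "\<dots> + (\<Sum>j\<le>n. smult (K n j * (int m - int j)) (ff (m + n - j)))
      = smult (K (Suc n) 0) (ff (m + Suc n)) + (\<Sum>j\<le>n. smult (K (Suc n) (Suc j)) (ff (m + n - j)))"
    by (simp add: rec smult_add_left sum.distrib add.assoc) (simp add: K_def)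
  also have "\<dots> = (\<Sum>j\<le>Suc n. smult (K (Suc n) j) (ff (m + Suc n - j)))"
    by (simp add: sum.atMost_Suc_shift del: sum.atMost_Suc)
  finally show ?case by (simp add: K_def)
qed

text \<open>Evaluation at m kills all terms beyond m and leaves h(m) as the sum of a_k k! binom(m,k)
  for k \<le> m, a unitriangular system in the a_k k!.\<close>

lemma dvd_ff_coeff_fact:
  assumes h: "h = (\<Sum>m<n. smult (a m) (ff m))" and dvd: "\<And>x. q dvd poly h (int x)" and "m < n"
  shows "q dvd a m * fact m"
  using \<open>m < n\<close>
proof (induction m rule: less_induct)
  case (less m)
  have "poly h (int m) = (\<Sum>k<n. a k * fact k * int (m choose k))"
    unfolding h by (simp add: poly_sum poly_ff mult.assoc)
  also have "\<dots> = (\<Sum>k<Suc m. a k * fact k * int (m choose k))"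
    using less.prems by (intro sum.mono_neutral_right) (auto simp: binomial_eq_0)
  also have "\<dots> = (\<Sum>k<m. a k * fact k * int (m choose k)) + a m * fact m" by simp
  finally have "a m * fact m = poly h (int m) - (\<Sum>k<m. a k * fact k * int (m choose k))" by simp
  moreover have "q dvd (\<Sum>k<m. a k * fact k * int (m choose k))"
    using less by (intro dvd_sum dvd_mult2[where b = "_ * fact _"]) auto
  ultimately show ?case using dvd[of m] by (simp add: dvd_diff)
qed

lemma multiplicity_of_nat: "multiplicity (int a) (int b) = multiplicity a b"
proof -
  have "int a ^ n dvd int b \<longleftrightarrow> a ^ n dvd b" for n
    by (metis int_dvd_int_iff of_nat_power)
  then show ?thesis unfolding multiplicity_def by simp
qed

lemma prime_power_dvd_cancel_fact:
  assumes p: "prime p" and dvd: "int p ^ s dvd a * fact m"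
  shows "int p ^ (s - multiplicity p (fact m :: nat)) dvd a"
proof (cases "a = 0")
  case False
  have pe: "prime_elem (int p)" using p by (simp add: prime_imp_prime_elem)
  have "multiplicity (int p) (int (fact m)) = multiplicity p (fact m :: nat)"
    by (rule multiplicity_of_nat)
  then have "multiplicity (int p) (fact m) = multiplicity p (fact m :: nat)" by simp
  moreover have "s \<le> multiplicity (int p) (a * fact m)"
    using dvd False pe by (intro multiplicity_geI) auto
  ultimately have "s - multiplicity p (fact m :: nat) \<le> multiplicity (int p) a"
    using False pe by (simp add: prime_elem_multiplicity_mult_distrib)
  then show ?thesis by (rule multiplicity_dvd')
qed simp

text \<open>Written as a range so that membership directly yields the coefficients \<open>b\<close>
  required for the resultant divisibility.\<close>

definition ff_span :: "(nat \<Rightarrow> int) \<Rightarrow> nat \<Rightarrow> int poly set" where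
  "ff_span c n = range (\<lambda>b. \<Sum>m<n. smult (b m) (smult (c m) (ff m)))"

lemma ff_span_0: "0 \<in> ff_span c n"
  unfolding ff_span_def by (rule range_eqI[of _ _ "\<lambda>_. 0"]) simp

lemma ff_span_add: "x \<in> ff_span c n \<Longrightarrow> y \<in> ff_span c n \<Longrightarrow> x + y \<in> ff_span c n"
  unfolding ff_span_def
proof safe
  fix a b
  show "(\<Sum>m<n. smult (a m) (smult (c m) (ff m))) + (\<Sum>m<n. smult (b m) (smult (c m) (ff m)))
      \<in> range (\<lambda>b. \<Sum>m<n. smult (b m) (smult (c m) (ff m)))"
    by (rule range_eqI[of _ _ "\<lambda>m. a m + b m"]) (simp add: sum.distrib smult_add_left algebra_simps)
qed

lemma ff_span_sum: "(\<And>i. i \<in> A \<Longrightarrow> h i \<in> ff_span c n) \<Longrightarrow> (\<Sum>i\<in>A. h i) \<in> ff_span c n"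
proof (induction A rule: infinite_finite_induct)
  case (insert x F)
  then show ?case by (simp add: ff_span_add)
qed (simp_all add: ff_span_0)

lemma ff_span_base:
  assumes "k < n" "c k dvd x"
  shows "smult x (ff k) \<in> ff_span c n"
proof -
  obtain y where y: "x = c k * y" using assms(2) by blast
  have "smult x (ff k) = (\<Sum>m<n. if m = k then smult y (smult (c m) (ff m)) else 0)"
    using assms(1) by (simp add: y mult.commute)
  also have "\<dots> = (\<Sum>m<n. smult (if m = k then y else 0) (smult (c m) (ff m)))"
    by (intro sum.cong) auto
  finally show ?thesis unfolding ff_span_def by (rule range_eqI[of _ _ "\<lambda>m. if m = k then y else 0"])
qed

text \<open>Expanding by \<open>ff_mult\<close>, each coefficient carries the two defects plus the
  valuation of the binomial expression, which \<open>defect_ff_mult\<close> shows to be enough.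
  Terms with j > l vanish.\<close>

lemma ff_span_mult:
  fixes p :: nat
  assumes p: "prime p" and res: "\<And>i. p * (\<delta> (Suc i) + \<gamma> (Suc i)) \<le> \<delta> i + \<gamma> i"
    and h: "h \<in> ff_span (\<lambda>m. int p ^ defect p K \<gamma> m) (Suc d)" and l: "l < e"
  shows "smult (int p ^ defect p K \<delta> l) (ff l) * h
    \<in> ff_span (\<lambda>m. int p ^ defect p K (\<lambda>i. \<delta> i + \<gamma> i) m) (d + e)"
proof -
  obtain b where b: "h = (\<Sum>m<Suc d. smult (b m) (smult (int p ^ defect p K \<gamma> m) (ff m)))"
    using h by (auto simp: ff_span_def)
  define C where "C m j = (l choose j) * (m choose j) * fact j" for m j
  have "smult (int p ^ defect p K \<delta> l) (ff l) * h
      = (\<Sum>m<Suc d. smult (int p ^ defect p K \<delta> l * (b m * int p ^ defect p K \<gamma> m)) (ff l * ff m))"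
    unfolding b sum_distrib_left by (intro sum.cong refl) (simp add: mult_ac)
  also have "\<dots> = (\<Sum>m<Suc d. \<Sum>j\<le>m.
      smult (int p ^ defect p K \<delta> l * (b m * int p ^ defect p K \<gamma> m) * int (C m j)) (ff (l + m - j)))"
    unfolding ff_mult C_def smult_sum2 smult_smult ..
  also have "\<dots> \<in> ff_span (\<lambda>m. int p ^ defect p K (\<lambda>i. \<delta> i + \<gamma> i) m) (d + e)"
  proof (intro ff_span_sum ff_span_base)
    fix m j assume mj: "m \<in> {..<Suc d}" "j \<in> {..m}"
    show "l + m - j < d + e" using mj l by auto
    show "int p ^ defect p K (\<lambda>i. \<delta> i + \<gamma> i) (l + m - j)
        dvd int p ^ defect p K \<delta> l * (b m * int p ^ defect p K \<gamma> m) * int (C m j)"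
    proof (cases "j \<le> l")
      case True
      have "int p ^ multiplicity p (C m j) dvd int (C m j)"
        using multiplicity_dvd[of p "C m j"] by (metis int_dvd_int_iff of_nat_power)
      then have "int p ^ (defect p K \<delta> l + defect p K \<gamma> m + multiplicity p (C m j))
          dvd (int p ^ defect p K \<delta> l * int p ^ defect p K \<gamma> m) * int (C m j)"
        unfolding power_add by (rule mult_dvd_mono[OF dvd_refl])
      then have "int p ^ defect p K (\<lambda>i. \<delta> i + \<gamma> i) (l + m - j)
          dvd (int p ^ defect p K \<delta> l * int p ^ defect p K \<gamma> m) * int (C m j)"
        using defect_ff_mult[where \<gamma> = \<delta> and \<delta> = \<gamma> and n = m, OF p True _ res, of K] mj
        by (auto simp: C_def intro: dvd_trans[OF le_imp_power_dvd])
      then have "int p ^ defect p K (\<lambda>i. \<delta> i + \<gamma> i) (l + m - j)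
          dvd b m * ((int p ^ defect p K \<delta> l * int p ^ defect p K \<gamma> m) * int (C m j))"
        by (rule dvd_mult)
      then show ?thesis by (simp only: mult_ac)
    qed (simp add: C_def binomial_eq_0)
  qed
  finally show ?thesis .
qed

lemma mem_ff_span_greedy:
  fixes p s :: nat
  assumes p: "prime p" and dvd: "\<And>n. int p ^ s dvd poly h (int n)"
  shows "h \<in> ff_span (\<lambda>m. int p ^ defect p K (greedy p s) m) (Suc (degree h))"
proof -
  obtain a where a: "h = (\<Sum>m<Suc (degree h). smult (a m) (ff m))"
    using ff_basis[of "Suc (degree h)" h] by (auto simp: coeff_eq_0)
  have "int p ^ defect p K (greedy p s) m dvd a m" if "m < Suc (degree h)" for m
    using prime_power_dvd_cancel_fact[OF p dvd_ff_coeff_fact[OF a dvd that]]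
      le_imp_power_dvd[OF defect_greedy_le[OF p]] by (rule dvd_trans[rotated])
  then show ?thesis by (subst a) (intro ff_span_sum ff_span_base, auto)
qed

text \<open>The leading coefficient 1 is a multiple of p^(defect at the degree), so that defect is
  0. With cutoff 1 it is just \<open>greedy p s 0 - degree h div p\<close>.\<close>

lemma greedy_le_degree:
  fixes p s :: nat
  assumes p: "prime p" and "monic h" and dvd: "\<And>n. int p ^ s dvd poly h (int n)"
  shows "p * greedy p s 0 \<le> degree h"
proof -
  obtain b where "h = (\<Sum>m<Suc (degree h). smult (b m) (smult (int p ^ defect p 1 (greedy p s) m) (ff m)))"
    using mem_ff_span_greedy[OF p dvd, of 1] by (auto simp: ff_span_def)
  then have "coeff h (degree h) = (\<Sum>m<Suc (degree h). b m * int p ^ defect p 1 (greedy p s) m * coeff (ff m) (degree h))"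
    by (metis (no_types, lifting) coeff_smult coeff_sum mult.assoc sum.cong)
  also have "\<dots> = b (degree h) * int p ^ defect p 1 (greedy p s) (degree h)"
    by (simp add: coeff_ff coeff_eq_0 degree_ff)
  finally have "int p ^ defect p 1 (greedy p s) (degree h) dvd 1"
    using \<open>monic h\<close> by (metis dvd_triv_right)
  then have "defect p 1 (greedy p s) (degree h) = 0"
    using prime_gt_1_nat[OF p] one_less_power[of "int p" "defect p 1 (greedy p s) (degree h)"]
    by (cases "defect p 1 (greedy p s) (degree h)") auto
  then show ?thesis
    using prime_gt_0_nat[OF p]
    by (simp add: defect_def less_eq_div_iff_mult_less_eq mult.commute)
qed

section \<open>The lower bound\<close>

theorem mainTheorem4:
  fixes p s1 s2 :: nat and f g :: "int poly"
  assumes "prime p"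
    and "monic f" and "monic g"
    and "\<forall>n::int. poly f n = 0 \<or> multiplicity (int p) (poly f n) \<ge> s1"
    and "\<forall>n::int. poly g n = 0 \<or> multiplicity (int p) (poly g n) \<ge> s2"
  shows "resultant f g = 0 \<or>
    multiplicity (int p) (resultant f g) \<ge>
      p * (\<Sum>i\<in>{i. min_resolution p s1 i * min_resolution p s2 i \<noteq> 0}.
             p ^ i * min_resolution p s1 i * min_resolution p s2 i)"
proof (rule disj_imp[THEN iffD2], rule impI)
  assume nz: "resultant f g \<noteq> 0"
  note p = \<open>prime p\<close>
  define \<gamma> where "\<gamma> = greedy p s1"
  define \<delta> where "\<delta> = greedy p s2"
  define d where "d = degree f"
  define e where "e = degree g"
  define T where "T = (\<Sum>i<s1. p ^ Suc i * \<gamma> i * \<delta> i)"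
  \<comment> \<open>One cutoff serves all three defects: \<delta> may extend past \<open>s1\<close>,
    but \<gamma> vanishes there, so the products in \<open>T\<close> lose nothing.\<close>
  let ?D = "defect p s1"
  have f: "int p ^ s1 dvd poly f n" and g: "int p ^ s2 dvd poly g n" for n
    using assms(4,5) by (metis dvd_0_right multiplicity_dvd')+
  have res: "p * \<gamma> (Suc i) \<le> \<gamma> i" "p * \<delta> (Suc i) \<le> \<delta> i" for i
    unfolding \<gamma>_def \<delta>_def by (rule greedy_resolution[OF p])+
  have sum_eq: "(\<Sum>m<d + e. ?D (\<lambda>i. \<gamma> i + \<delta> i) m) = (\<Sum>m<d. ?D \<gamma> m) + (\<Sum>m<e. ?D \<delta> m) + T"
    unfolding T_def d_def e_def \<gamma>_def \<delta>_def
    using prime_gt_0_nat[OF p] greedy_resolution[OF p] greedy_le_degree[OF p] assms(2,3) f g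
    by (intro sum_defect_add) auto
  have "(\<Prod>m<degree f + degree g. coeff (smult (int p ^ ?D (\<lambda>i. \<gamma> i + \<delta> i) m) (ff m)) m)
    dvd (\<Prod>j<degree g. coeff (smult (int p ^ ?D \<delta> j) (ff j)) j)
      * (\<Prod>j<degree f. coeff (smult (int p ^ ?D \<gamma> j) (ff j)) j) * resultant f g"
  proof (rule prod_coeff_dvd_resultant)
    fix j assume "j < degree g"
    moreover have "f \<in> ff_span (\<lambda>m. int p ^ ?D \<gamma> m) (Suc (degree f))"
      unfolding \<gamma>_def using f by (intro mem_ff_span_greedy[OF p])
    ultimately have "smult (int p ^ ?D \<delta> j) (ff j) * f
        \<in> ff_span (\<lambda>m. int p ^ ?D (\<lambda>i. \<delta> i + \<gamma> i) m) (degree f + degree g)"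
      using res by (intro ff_span_mult[OF p]) (auto simp: distrib_left intro: add_mono)
    then show "\<exists>b. smult (int p ^ ?D \<delta> j) (ff j) * f
        = (\<Sum>m<degree f + degree g. smult (b m) (smult (int p ^ ?D (\<lambda>i. \<gamma> i + \<delta> i) m) (ff m)))"
      unfolding ff_span_def add.commute[of "\<gamma> _"] by blast
  next
    fix j assume "j < degree f"
    moreover have "g \<in> ff_span (\<lambda>m. int p ^ ?D \<delta> m) (Suc (degree g))"
      unfolding \<delta>_def using g by (intro mem_ff_span_greedy[OF p])
    ultimately have "smult (int p ^ ?D \<gamma> j) (ff j) * g
        \<in> ff_span (\<lambda>m. int p ^ ?D (\<lambda>i. \<gamma> i + \<delta> i) m) (degree g + degree f)"
      using res by (intro ff_span_mult[OF p]) (auto simp: distrib_left intro: add_mono)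
    then show "\<exists>b. smult (int p ^ ?D \<gamma> j) (ff j) * g
        = (\<Sum>m<degree f + degree g. smult (b m) (smult (int p ^ ?D (\<lambda>i. \<gamma> i + \<delta> i) m) (ff m)))"
      unfolding ff_span_def add.commute[of "degree g"] by blast
  qed (auto intro: order.trans[OF degree_smult_le] simp: degree_ff)
  then have "int p ^ (\<Sum>m<d + e. ?D (\<lambda>i. \<gamma> i + \<delta> i) m)
      dvd int p ^ ((\<Sum>m<d. ?D \<gamma> m) + (\<Sum>m<e. ?D \<delta> m)) * resultant f g"
    by (simp add: coeff_ff d_def e_def power_sum power_add mult.commute)
  \<comment> \<open>By \<open>sum_eq\<close> the left exponent exceeds the right one by exactly
    \<open>T\<close>; the common power cancels.\<close>
  then have "int p ^ T dvd resultant f g"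
    unfolding sum_eq power_add[of _ _ T] using prime_gt_0_nat[OF p] by simp
  then have "T \<le> multiplicity (int p) (resultant f g)"
    using nz prime_gt_1_nat[OF p] by (intro multiplicity_geI) auto
  moreover have "(\<Sum>i\<in>{i. \<gamma> i * \<delta> i \<noteq> 0}. p ^ i * \<gamma> i * \<delta> i) = (\<Sum>i<s1. p ^ i * \<gamma> i * \<delta> i)"
    unfolding \<gamma>_def
    by (intro sum.mono_neutral_left) (auto intro!: greedy_nz_imp_less[of p s1])
  then have "p * (\<Sum>i\<in>{i. \<gamma> i * \<delta> i \<noteq> 0}. p ^ i * \<gamma> i * \<delta> i) = T"
    unfolding T_def by (simp add: sum_distrib_left mult.assoc)
  ultimately show "p * (\<Sum>i\<in>{i. min_resolution p s1 i * min_resolution p s2 i \<noteq> 0}.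
             p ^ i * min_resolution p s1 i * min_resolution p s2 i) \<le> multiplicity (int p) (resultant f g)"
    unfolding min_resolution_eq_greedy[OF p] \<gamma>_def \<delta>_def by simp
qed

end
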